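(* $\langle\{\mathrm{Ising}_2^\lambda:0\le\lambda\le1\}\cup\mathcal{B}_0\rangle=\mathcal{E}$.
   Context: $\mathcal{B}_k$ is the set of functions $\{0,1\}^k\to\mathbb{R}_{\ge0}$, $\mathcal{B}=\bigcup_k\mathcal{B}_k$, with $\mathcal{B}_0$ identified with $\mathbb{R}_{\ge0}$. $\mathrm{EQ}$ is the binary equality indicator. $\langle\mathcal{F}\rangle$ (functional clone generated by $\mathcal{F}$; no limits) is the closure of $\mathcal{F}\cup\{\mathrm{EQ}\}$ under introducing fictitious arguments, permuting arguments, pointwise product of equal-arity functions, and summing out an argument over $\{0,1\}$. $\mathrm{Ising}_2^\lambda$ is the binary function with value 1 on $(0,0),(1,1)$ and $\lambda$ on $(0,1),(1,0)$. Fourier transform: $\widehat f(\mathbf{x})=2^{-k}\sum_{\mathbf{w}\in\{0,1\}^k}(-1)^{|\mathbf{w}\wedge\mathbf{x}|}f(\mathbf{w})$ ($|\cdot|$ Hamming weight). An arity-$k$ even-circuit is an undirected graph with external degree-1 vertices $u_1,\dots,u_k$ whose incident edges $y_1,\dots,y_k$ (terminals) have weight 1, internal vertices $v_1,\dots,v_n$ ($n\ge k$), and weights $w_e\in(0,1]$ on the other edges; it implements $f(y_1,\dots,y_k)=\sum_H\prod_{e\in H}w_e$ over edge sets $H$ containing exactly the terminals set to 1 in which every internal vertex has even degree (empty product 1). $\mathcal{E}$ is the set of functions $c\cdot f\in\mathcal{B}$ with $c\ge0$ real and $\widehat f$ implemented by an even-circuit. *)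

theory Defs
  imports Complex_Main "HOL-Library.FuncSet" "HOL-Combinatorics.Permutations"
begin

section \<open>Nonnegative functions on the Boolean cube\<close>

definition cube :: "nat \<Rightarrow> bool list set" where
  "cube k = {x. length x = k}"

text \<open>A function carries its arity explicitly and is \<^const>\<open>undefined\<close> off its cube, so that equality
  of pairs is equality of functions together with their arities. The elements of \<open>B 0\<close> are the pairs
  \<open>(0, f)\<close> where \<open>f\<close> is determined by the single value \<open>f []\<close>.\<close>

type_synonym bfun = "nat \<times> (bool list \<Rightarrow> real)"

definition B :: "nat \<Rightarrow> bfun set" where
  "B k = {(k, f) | f. f \<in> cube k \<rightarrow>\<^sub>E {0..}}"

definition EQ :: bfun where
  "EQ = (2, \<lambda>x\<in>cube 2. if x ! 0 = x ! 1 then 1 else 0)"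

definition Ising :: "real \<Rightarrow> bfun" where
  "Ising l = (2, \<lambda>x\<in>cube 2. if x ! 0 = x ! 1 then 1 else l)"

section \<open>Functional clones\<close>

definition insert_at :: "nat \<Rightarrow> 'a \<Rightarrow> 'a list \<Rightarrow> 'a list" where
  "insert_at p b x = take p x @ b # drop p x"

definition delete_at :: "nat \<Rightarrow> 'a list \<Rightarrow> 'a list" where
  "delete_at p x = take p x @ drop (Suc p) x"

inductive_set clone :: "bfun set \<Rightarrow> bfun set" for F :: "bfun set" where
  generator: "f \<in> F \<Longrightarrow> f \<in> clone F"
| equality: "EQ \<in> clone F"
| fictitious: "(k, f) \<in> clone F \<Longrightarrow> p \<le> k \<Longrightarrow>
    (Suc k, \<lambda>x\<in>cube (Suc k). f (delete_at p x)) \<in> clone F"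
| permute: "(k, f) \<in> clone F \<Longrightarrow> \<pi> permutes {..<k} \<Longrightarrow>
    (k, \<lambda>x\<in>cube k. f (map (\<lambda>i. x ! \<pi> i) [0..<k])) \<in> clone F"
| product: "(k, f) \<in> clone F \<Longrightarrow> (k, g) \<in> clone F \<Longrightarrow>
    (k, \<lambda>x\<in>cube k. f x * g x) \<in> clone F"
| summation: "(Suc k, f) \<in> clone F \<Longrightarrow> p \<le> k \<Longrightarrow>
    (k, \<lambda>x\<in>cube k. \<Sum>b\<in>UNIV. f (insert_at p b x)) \<in> clone F"

section \<open>Fourier transform\<close>

definition hamming_weight :: "bool list \<Rightarrow> nat" where
  "hamming_weight x = length (filter id x)"

definition fourier :: "nat \<Rightarrow> (bool list \<Rightarrow> real) \<Rightarrow> bool list \<Rightarrow> real" where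
  "fourier k f = (\<lambda>x\<in>cube k.
     1 / 2 ^ k * (\<Sum>w\<in>cube k. (- 1) ^ hamming_weight (map2 (\<and>) w x) * f w))"

section \<open>Even-circuits\<close>

text \<open>External vertices are \<open>Ext 0, \<dots>, Ext (k - 1)\<close>, internal ones \<open>Inn 0, \<dots>, Inn (n - 1)\<close>;
  graphs are simple, with edges represented as two-element sets of vertices.\<close>

datatype vertex = Ext nat | Inn nat

definition vertices :: "nat \<Rightarrow> nat \<Rightarrow> vertex set" where
  "vertices k n = Ext ` {..<k} \<union> Inn ` {..<n}"

definition degree :: "vertex set set \<Rightarrow> vertex \<Rightarrow> nat" where
  "degree E v = card {e \<in> E. v \<in> e}"

definition terminal :: "vertex set set \<Rightarrow> nat \<Rightarrow> vertex set" where
  "terminal E i = (THE e. e \<in> E \<and> Ext i \<in> e)"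

text \<open>The terminals are the argument places of the implemented function, so they are \<open>k\<close> distinct
  edges; in other words no edge joins two external vertices.\<close>

locale even_circuit =
  fixes k n :: nat and E :: "vertex set set" and w :: "vertex set \<Rightarrow> real"
  assumes internal: "k \<le> n"
    and edges: "E \<subseteq> {{a, b} | a b. a \<in> vertices k n \<and> b \<in> vertices k n \<and> a \<noteq> b}"
    and external_degree: "i < k \<Longrightarrow> degree E (Ext i) = 1"
    and terminals_distinct: "inj_on (terminal E) {..<k}"
    and terminal_weight: "i < k \<Longrightarrow> w (terminal E i) = 1"
    and weight: "e \<in> E - terminal E ` {..<k} \<Longrightarrow> 0 < w e \<and> w e \<le> 1"

definition even_subgraphs :: "nat \<Rightarrow> nat \<Rightarrow> vertex set set \<Rightarrow> bool list \<Rightarrow> vertex set set set" where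
  "even_subgraphs k n E x =
     {H. H \<subseteq> E \<and> (\<forall>i<k. terminal E i \<in> H \<longleftrightarrow> x ! i) \<and> (\<forall>j<n. even (degree H (Inn j)))}"

definition circuit_implements ::
    "nat \<Rightarrow> nat \<Rightarrow> vertex set set \<Rightarrow> (vertex set \<Rightarrow> real) \<Rightarrow> (bool list \<Rightarrow> real) \<Rightarrow> bool" where
  "circuit_implements k n E w f \<longleftrightarrow>
     (\<forall>x\<in>cube k. f x = (\<Sum>H\<in>even_subgraphs k n E x. \<Prod>e\<in>H. w e))"

definition even_circuit_functions :: "bfun set" where
  "even_circuit_functions =
     {(k, \<lambda>x\<in>cube k. c * f x) | k c f.
        0 \<le> c \<and> (k, \<lambda>x\<in>cube k. c * f x) \<in> B k \<and>
        (\<exists>n E w. even_circuit k n E w \<and> circuit_implements k n E w (fourier k f))}"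

end

theory Submission
  imports Defs
begin

text \<open>Every function of the clone has a normal form: up to a constant it is the partition function of
  an Ising model on a finite graph, in which the spins of a list of vertices are fixed by the
  arguments and each edge \<open>e = {a, b}\<close> contributes \<open>1 + w\<^sub>e \<sigma>\<^sub>a \<sigma>\<^sub>b\<close> with \<open>0 < w\<^sub>e \<le> 1\<close>. This factor is
  \<open>1 + w\<^sub>e\<close> times \<open>Ising \<lambda>\<close> for \<open>\<lambda> = (1 - w\<^sub>e) / (1 + w\<^sub>e)\<close>. The terminal of a circuit at the
  argument \<open>x\<^sub>i = \<plusminus>1\<close> contributes \<open>1 + x\<^sub>i \<sigma>\<close>, which fixes the spin \<open>\<sigma>\<close>. Expanding the product over all
  edges and summing over the spins (the high temperature expansion) leaves exactly the even
  subgraphs, graded by the characters \<open>\<Prod> x\<^sub>i\<close> over their terminals; so the circuit implements the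
  Fourier transform of the partition function, up to a constant.\<close>

section \<open>Boolean lists\<close>

lemma mem_cube_iff [simp]: "x \<in> cube k \<longleftrightarrow> length x = k"
  by (simp add: cube_def)

lemma cube_0 [simp]: "cube 0 = {[]}"
  by (auto simp: cube_def)

lemma finite_cube [simp]: "finite (cube k)"
  using finite_lists_length_eq[of "UNIV :: bool set" k] by (simp add: cube_def)

lemma sum_cube_add:
  "(\<Sum>z\<in>cube (m + n). f z) = (\<Sum>x\<in>cube m. \<Sum>y\<in>cube n. f (x @ y))"
  unfolding sum.cartesian_product
  by (rule sum.reindex_bij_witness[of _ "\<lambda>(x, y). x @ y" "\<lambda>z. (take m z, drop m z)"]) auto

lemma sum_cube_1: "(\<Sum>x\<in>cube (Suc 0). f x) = f [False] + f [True]"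
proof -
  have "cube (Suc 0) = {[False], [True]}"
    by (auto simp: cube_def length_Suc_conv)
  then show ?thesis by simp
qed

lemma sum_cube_Suc:
  "(\<Sum>x\<in>cube (Suc k). f x) = (\<Sum>x\<in>cube k. \<Sum>b\<in>UNIV. f (b # x))"
proof -
  have "(\<Sum>x\<in>cube (Suc k). f x) = (\<Sum>x\<in>cube k. f (False # x)) + (\<Sum>x\<in>cube k. f (True # x))"
    using sum_cube_add[of f "Suc 0" k] by (simp add: sum_cube_1)
  then show ?thesis by (simp add: UNIV_bool sum.distrib)
qed

text \<open>Each coordinate occurs in one factor only, so the sum factorises. This serves twice: for
  the orthogonality of characters and for summing out spins.\<close>

lemma sum_cube_prod:
  fixes h :: "nat \<Rightarrow> bool \<Rightarrow> 'a::comm_semiring_1"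
  shows "(\<Sum>x\<in>cube n. \<Prod>j<n. h j (x ! j)) = (\<Prod>j<n. h j False + h j True)"
proof (induction n arbitrary: h)
  case (Suc n)
  have "(\<Sum>x\<in>cube (Suc n). \<Prod>j<Suc n. h j (x ! j))
      = (\<Sum>x\<in>cube n. \<Sum>b\<in>UNIV. h 0 b * (\<Prod>j<n. h (Suc j) (x ! j)))"
    by (simp add: sum_cube_Suc prod.lessThan_Suc_shift del: prod.lessThan_Suc)
  also have "\<dots> = (h 0 False + h 0 True) * (\<Sum>x\<in>cube n. \<Prod>j<n. h (Suc j) (x ! j))"
    by (simp add: UNIV_bool sum_distrib_left algebra_simps)
  also have "\<dots> = (\<Prod>j<Suc n. h j False + h j True)"
    using Suc.IH[of "\<lambda>j. h (Suc j)"] by (simp add: prod.lessThan_Suc_shift del: prod.lessThan_Suc)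
  finally show ?case .
qed simp

lemma length_insert_at [simp]: "length (insert_at p b x) = Suc (length x)"
  by (simp add: insert_at_def)

lemma length_delete_at [simp]: "p < length x \<Longrightarrow> length (delete_at p x) = length x - 1"
  by (simp add: delete_at_def)

lemma map_insert_at: "map f (insert_at p b x) = insert_at p (f b) (map f x)"
  by (simp add: insert_at_def take_map drop_map)

lemma map_delete_at: "map f (delete_at p x) = delete_at p (map f x)"
  by (simp add: delete_at_def take_map drop_map)

lemma set_delete_at_subset: "set (delete_at p x) \<subseteq> set x"
  using set_take_subset[of p x] set_drop_subset[of "Suc p" x] by (auto simp: delete_at_def)

lemma set_insert_at [simp]: "set (insert_at p b x) = insert b (set x)"
proof -
  have "set x = set (take p x) \<union> set (drop p x)"
    by (metis append_take_drop_id set_append)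
  then show ?thesis by (auto simp: insert_at_def)
qed

text \<open>Splits a constraint on a lengthened tuple into one on the new entry and one on the rest.
  The closure proofs for fictitious arguments and for summation rest on it.\<close>

lemma insert_at_eq_iff:
  assumes "length x = Suc (length y)" "p \<le> length y"
  shows "insert_at p b y = x \<longleftrightarrow> b = x ! p \<and> y = delete_at p x"
proof
  assume "insert_at p b y = x"
  then show "b = x ! p \<and> y = delete_at p x"
    using assms by (auto simp: insert_at_def delete_at_def nth_append)
next
  assume "b = x ! p \<and> y = delete_at p x"
  then show "insert_at p b y = x"
    using assms by (simp add: insert_at_def delete_at_def min_def id_take_nth_drop[symmetric])
qed

section \<open>Fourier inversion\<close>

text \<open>The sign convention makes \<open>spin (a \<and> b)\<close> the contribution of one
  position to the Fourier kernel.\<close>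

definition spin :: "bool \<Rightarrow> real" where
  "spin b = (if b then -1 else 1)"

lemma spin_mult: "spin a * spin b = (if a = b then 1 else -1)"
  by (simp add: spin_def)

definition character :: "bool list \<Rightarrow> bool list \<Rightarrow> real" where
  "character w x = (-1) ^ hamming_weight (map2 (\<and>) w x)"

lemma character_eq_prod:
  "length w = k \<Longrightarrow> length x = k \<Longrightarrow> character w x = (\<Prod>i<k. spin (w ! i \<and> x ! i))"
proof (induction k arbitrary: w x)
  case 0
  then show ?case by (simp add: character_def hamming_weight_def)
next
  case (Suc k)
  obtain b w' c x' where *: "w = b # w'" "x = c # x'" "length w' = k" "length x' = k"
    using Suc.prems by (auto simp: length_Suc_conv)
  have "character w x = spin (b \<and> c) * character w' x'"
    by (simp add: * character_def hamming_weight_def spin_def)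
  then show ?case
    using Suc.IH[of w' x'] * by (simp add: prod.lessThan_Suc_shift del: prod.lessThan_Suc)
qed

text \<open>The sum factorises over positions, where position \<open>i\<close> gives
  \<open>1 + spin (x ! i) * spin (y ! i)\<close>: this is 2 if the entries agree and 0
  otherwise.\<close>

lemma character_orthogonal:
  assumes "length x = k" "length y = k"
  shows "(\<Sum>w\<in>cube k. character w x * character w y) = (if x = y then 2 ^ k else 0)"
proof -
  have "(\<Sum>w\<in>cube k. character w x * character w y)
      = (\<Sum>w\<in>cube k. \<Prod>i<k. spin (w ! i \<and> x ! i) * spin (w ! i \<and> y ! i))"
    using assms by (intro sum.cong) (auto simp: character_eq_prod prod.distrib)
  also have "\<dots> = (\<Prod>i<k. if x ! i = y ! i then 2 else 0)"
    by (subst sum_cube_prod) (auto simp: spin_def intro!: prod.cong)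
  also have "\<dots> = (if x = y then 2 ^ k else 0)"
    using assms by (auto simp: list_eq_iff_nth_eq prod_zero_iff)
  finally show ?thesis .
qed

lemma character_commute: "length w = length x \<Longrightarrow> character w x = character x w"
  by (simp add: character_eq_prod conj_commute)

lemma fourier_eq:
  "length x = k \<Longrightarrow> fourier k f x = (\<Sum>w\<in>cube k. character w x * f w) / 2 ^ k"
  by (simp add: fourier_def character_def)

text \<open>Recovers a function from the transform that a given circuit implements.\<close>

lemma fourier_inversion:
  assumes "length y = k"
  shows "(\<Sum>x\<in>cube k. character y x * fourier k f x) = f y"
proof -
  have "(\<Sum>x\<in>cube k. character y x * fourier k f x)
      = (\<Sum>x\<in>cube k. \<Sum>w\<in>cube k. character x y * character x w * f w) / 2 ^ k"
    using assms
    by (simp add: fourier_eq sum_divide_distrib sum_distrib_left mult.assoc character_commute)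
  also have "\<dots> = (\<Sum>w\<in>cube k. (\<Sum>x\<in>cube k. character x y * character x w) * f w) / 2 ^ k"
    by (subst sum.swap) (simp add: sum_distrib_right)
  also have "\<dots> = (\<Sum>w\<in>cube k. if w = y then 2 ^ k * f w else 0) / 2 ^ k"
    using assms by (intro arg_cong2[where f = "(/)"] sum.cong) (auto simp: character_orthogonal)
  also have "\<dots> = f y"
    using assms by simp
  finally show ?thesis .
qed

text \<open>The opposite direction: identifies the transform of a function already written as a
  combination of characters, as the high temperature expansion provides.\<close>

lemma fourier_of_inverse:
  assumes "length x = k" and f: "\<And>y. length y = k \<Longrightarrow> f y = (\<Sum>x\<in>cube k. character y x * g x)"
  shows "fourier k f x = g x"
proof -
  have "fourier k f x = (\<Sum>w\<in>cube k. \<Sum>y\<in>cube k. character w x * character w y * g y) / 2 ^ k"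
    using assms by (simp add: fourier_eq sum_distrib_left mult.assoc)
  also have "\<dots> = (\<Sum>y\<in>cube k. (\<Sum>w\<in>cube k. character w x * character w y) * g y) / 2 ^ k"
    by (subst sum.swap) (simp add: sum_distrib_right)
  also have "\<dots> = (\<Sum>y\<in>cube k. if y = x then 2 ^ k * g y else 0) / 2 ^ k"
    using assms by (intro arg_cong2[where f = "(/)"] sum.cong) (auto simp: character_orthogonal)
  also have "\<dots> = g x"
    using assms by simp
  finally show ?thesis .
qed

section \<open>Ising partition functions\<close>

definition boltzmann :: "(nat \<times> nat) set \<Rightarrow> (nat \<times> nat \<Rightarrow> real) \<Rightarrow> bool list \<Rightarrow> real" where
  "boltzmann P W s = (\<Prod>p\<in>P. 1 + W p * (spin (s ! fst p) * spin (s ! snd p)))"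

text \<open>Spins listed in \<open>t\<close> are pinned to the arguments and all others are summed
  out. A vertex repeated in \<open>t\<close> forces the corresponding arguments to agree.\<close>

definition gibbs ::
    "nat \<Rightarrow> nat list \<Rightarrow> (nat \<times> nat) set \<Rightarrow> (nat \<times> nat \<Rightarrow> real) \<Rightarrow> bool list \<Rightarrow> real" where
  "gibbs n t P W x = (\<Sum>s\<in>cube n. of_bool (map ((!) s) t = x) * boltzmann P W s)"

text \<open>Requiring \<open>fst p < snd p\<close> excludes loops and stores each undirected edge
  once, so that pairs match the two-element sets of a circuit. Weight 0 is excluded as in circuits;
  such an edge is left out instead.\<close>

definition network ::
    "nat \<Rightarrow> nat \<Rightarrow> nat list \<Rightarrow> (nat \<times> nat) set \<Rightarrow> (nat \<times> nat \<Rightarrow> real) \<Rightarrow> bool" where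
  "network k n t P W \<longleftrightarrow> length t = k \<and> set t \<subseteq> {..<n} \<and>
     (\<forall>p\<in>P. fst p < snd p \<and> snd p < n \<and> 0 < W p \<and> W p \<le> 1)"

definition gibbs_functions :: "bfun set" where
  "gibbs_functions = {(k, \<lambda>x\<in>cube k. c * gibbs n t P W x) | k n t P W c.
     0 \<le> c \<and> network k n t P W}"

lemma network_finite: "network k n t P W \<Longrightarrow> finite P"
  by (rule finite_subset[of _ "{..<n} \<times> {..<n}"]) (force simp: network_def)+

lemma gibbs_functionsI:
  assumes "network k n t P W" "0 \<le> c" "\<And>x. length x = k \<Longrightarrow> f x = c * gibbs n t P W x"
  shows "(k, \<lambda>x\<in>cube k. f x) \<in> gibbs_functions"
proof -
  have "(\<lambda>x\<in>cube k. f x) = (\<lambda>x\<in>cube k. c * gibbs n t P W x)"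
    using assms by (intro restrict_ext) simp
  then show ?thesis using assms unfolding gibbs_functions_def by blast
qed

lemma gibbs_functionsE:
  assumes "(k, f) \<in> gibbs_functions"
  obtains n t P W c where "network k n t P W" "0 \<le> c"
    "\<And>x. length x = k \<Longrightarrow> f x = c * gibbs n t P W x"
  using assms unfolding gibbs_functions_def by auto

lemma boltzmann_append:
  assumes "network k n t P W" "length s = n"
  shows "boltzmann P W (s @ r) = boltzmann P W s"
  unfolding boltzmann_def
  using assms by (intro prod.cong refl) (auto simp: network_def nth_append)

lemma map_nth_append:
  assumes "set t \<subseteq> {..<length s}"
  shows "map ((!) (s @ r)) t = map ((!) s) t"
  using assms by (auto simp: nth_append)

lemma gibbs_upt: "length x = n \<Longrightarrow> gibbs n [0..<n] P W x = boltzmann P W x"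
proof -
  assume x: "length x = n"
  have "gibbs n [0..<n] P W x = (\<Sum>s\<in>cube n. if s = x then boltzmann P W s else 0)"
    unfolding gibbs_def by (intro sum.cong) (auto simp: map_nth)
  then show ?thesis using x by simp
qed

section \<open>Generators, and closure of the normal form under the clone operations\<close>

lemma Ising_gibbs:
  assumes "0 \<le> l" "l \<le> 1"
  shows "Ising l \<in> gibbs_functions"
  unfolding Ising_def
proof (rule gibbs_functionsI)
  \<comment> \<open>The weight solves \<open>(1 - w) / (1 + w) = l\<close>. At \<open>l = 1\<close>
    it would be 0, which is not allowed, so the edge is dropped.\<close>
  let ?P = "if l = 1 then {} else {(0::nat, 1::nat)}" and ?W = "\<lambda>_. (1 - l) / (1 + l)"
  show "network 2 2 [0..<2] ?P ?W"
    using assms by (auto simp: network_def)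
  show "0 \<le> (1 + l) / 2" using assms by simp
  show "(if x ! 0 = x ! 1 then 1 else l) = (1 + l) / 2 * gibbs 2 [0..<2] ?P ?W x"
    if "length x = 2" for x
  proof -
    have "boltzmann ?P ?W x = (if x ! 0 = x ! 1 then 2 / (1 + l) else 2 * l / (1 + l))"
      using assms by (auto simp: boltzmann_def spin_mult divide_simps)
    then show ?thesis
      unfolding gibbs_upt[OF that] using assms by (simp add: divide_simps)
  qed
qed

lemma EQ_gibbs: "EQ \<in> gibbs_functions"
  unfolding EQ_def
proof (rule gibbs_functionsI)
  \<comment> \<open>Both arguments read the same single spin.\<close>
  show "network 2 1 [0, 0] {} (\<lambda>_. 1)" by (simp add: network_def)
  show "(if x ! 0 = x ! 1 then 1 else 0) = 1 * gibbs 1 [0, 0] {} (\<lambda>_. 1) x"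
    if "length x = 2" for x
    using that by (cases "x ! 0")
      (auto simp: gibbs_def boltzmann_def sum_cube_1 numeral_2_eq_2 length_Suc_conv)
qed simp

lemma B_0_gibbs:
  assumes "f \<in> B 0"
  shows "f \<in> gibbs_functions"
proof -
  obtain g where g: "f = (0, g)" "g \<in> cube 0 \<rightarrow>\<^sub>E {0..}"
    using assms by (auto simp: B_def)
  have "g = (\<lambda>x\<in>cube 0. g x)"
    using g(2) by (metis PiE_restrict)
  moreover have "(0, \<lambda>x\<in>cube 0. g x) \<in> gibbs_functions"
  proof (rule gibbs_functionsI)
    show "network 0 0 [] {} (\<lambda>_. 1)" by (simp add: network_def)
    show "0 \<le> g []" using g(2) by auto
    show "g x = g [] * gibbs 0 [] {} (\<lambda>_. 1) x" if "length x = 0" for x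
      using that by (simp add: gibbs_def boltzmann_def)
  qed
  ultimately show ?thesis using g(1) by simp
qed

text \<open>The new argument reads a fresh isolated spin. Exactly one of its two values is
  compatible with the argument, so the sum is unchanged.\<close>

lemma fictitious_gibbs:
  assumes "(k, f) \<in> gibbs_functions" "p \<le> k"
  shows "(Suc k, \<lambda>x\<in>cube (Suc k). f (delete_at p x)) \<in> gibbs_functions"
proof -
  obtain n t P W c where N: "network k n t P W" and c: "0 \<le> c"
    and f: "\<And>x. length x = k \<Longrightarrow> f x = c * gibbs n t P W x"
    by (rule gibbs_functionsE[OF assms(1)]) blast
  have t: "length t = k" "set t \<subseteq> {..<n}" using N by (auto simp: network_def)
  show ?thesis
  proof (rule gibbs_functionsI[OF _ c])
    show "network (Suc k) (Suc n) (insert_at p n t) P W"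
      using N by (auto simp: network_def less_Suc_eq)
    fix x :: "bool list"
    assume x: "length x = Suc k"
    have "gibbs (n + Suc 0) (insert_at p n t) P W x
        = (\<Sum>s\<in>cube n. \<Sum>r\<in>cube (Suc 0).
            of_bool (insert_at p (r ! 0) (map ((!) s) t) = x) * boltzmann P W s)"
      unfolding gibbs_def sum_cube_add using t
      by (intro sum.cong refl)
        (simp add: map_insert_at map_nth_append boltzmann_append[OF N] nth_append)
    also have "\<dots> = (\<Sum>s\<in>cube n. of_bool (map ((!) s) t = delete_at p x) * boltzmann P W s)"
      using x t assms(2) by (intro sum.cong) (auto simp: sum_cube_1 insert_at_eq_iff)
    finally show "f (delete_at p x) = c * gibbs (Suc n) (insert_at p n t) P W x"
      using x f assms(2) by (simp add: gibbs_def)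
  qed
qed

lemma permute_gibbs:
  assumes "(k, f) \<in> gibbs_functions" "\<pi> permutes {..<k}"
  shows "(k, \<lambda>x\<in>cube k. f (map (\<lambda>i. x ! \<pi> i) [0..<k])) \<in> gibbs_functions"
proof -
  obtain n t P W c where N: "network k n t P W" and c: "0 \<le> c"
    and f: "\<And>x. length x = k \<Longrightarrow> f x = c * gibbs n t P W x"
    by (rule gibbs_functionsE[OF assms(1)]) blast
  have t: "length t = k" "set t \<subseteq> {..<n}" using N by (auto simp: network_def)
  \<comment> \<open>The constraint \<open>s ! (t ! i) = x ! \<pi> i\<close> becomes one on
    \<open>x ! j\<close> by substituting \<open>j = \<pi> i\<close>; hence the inverse.\<close>
  define u where "u = map (\<lambda>i. t ! inv \<pi> i) [0..<k]"
  have pi: "\<pi> i < k \<longleftrightarrow> i < k" "inv \<pi> i < k \<longleftrightarrow> i < k" for i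
    using permutes_in_image[OF assms(2)] permutes_in_image[OF permutes_inv[OF assms(2)]] by auto
  have inv: "inv \<pi> (\<pi> i) = i" "\<pi> (inv \<pi> i) = i" for i
    using permutes_inverses[OF assms(2)] by auto
  show ?thesis
  proof (rule gibbs_functionsI[OF _ c])
    show "network k n u P W"
      using N t pi by (auto simp: network_def u_def subset_iff)
    fix x :: "bool list"
    assume x: "length x = k"
    have "map ((!) s) t = map (\<lambda>i. x ! \<pi> i) [0..<k] \<longleftrightarrow> map ((!) s) u = x" for s :: "bool list"
    proof -
      have "(\<forall>i<k. s ! (t ! i) = x ! \<pi> i) \<longleftrightarrow> (\<forall>i<k. s ! (t ! inv \<pi> i) = x ! i)"
        using pi inv by metis
      then show ?thesis
        using x t by (simp add: list_eq_iff_nth_eq u_def)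
    qed
    then show "f (map (\<lambda>i. x ! \<pi> i) [0..<k]) = c * gibbs n u P W x"
      using x f by (simp add: gibbs_def)
  qed
qed

text \<open>Dropping the entry \<open>p\<close> of \<open>t\<close> removes one pinning condition.
  For each spin configuration exactly one value of the summed argument meets that condition, so
  summing over the argument has the same effect.\<close>

lemma summation_gibbs:
  assumes "(Suc k, f) \<in> gibbs_functions" "p \<le> k"
  shows "(k, \<lambda>x\<in>cube k. \<Sum>b\<in>UNIV. f (insert_at p b x)) \<in> gibbs_functions"
proof -
  obtain n t P W c where N: "network (Suc k) n t P W" and c: "0 \<le> c"
    and f: "\<And>x. length x = Suc k \<Longrightarrow> f x = c * gibbs n t P W x"
    by (rule gibbs_functionsE[OF assms(1)]) blast
  have t: "length t = Suc k" "set t \<subseteq> {..<n}" using N by (auto simp: network_def)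
  show ?thesis
  proof (rule gibbs_functionsI[OF _ c])
    show "network k n (delete_at p t) P W"
      using N assms(2) set_delete_at_subset[of p t] by (auto simp: network_def)
    fix x :: "bool list"
    assume x: "length x = k"
    have "of_bool (map ((!) s) (delete_at p t) = x)
        = (\<Sum>b\<in>UNIV. of_bool (map ((!) s) t = insert_at p b x) :: real)" for s
    proof -
      have "map ((!) s) t = insert_at p b x \<longleftrightarrow> b = s ! (t ! p) \<and> map ((!) s) (delete_at p t) = x" for b
        unfolding eq_commute[of "map ((!) s) t"] using x t assms(2)
        by (subst insert_at_eq_iff) (simp_all add: map_delete_at conj_commute eq_commute[of x])
      then show ?thesis by (auto simp: UNIV_bool)
    qed
    then have "gibbs n (delete_at p t) P W x = (\<Sum>b\<in>UNIV. gibbs n t P W (insert_at p b x))"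
      unfolding gibbs_def by (subst sum.swap) (simp add: sum_distrib_right)
    then show "(\<Sum>b\<in>UNIV. f (insert_at p b x)) = c * gibbs n (delete_at p t) P W x"
      using x f by (simp add: sum_distrib_left)
  qed
qed

text \<open>Place the two graphs side by side and join the vertices read by the same argument with
  an edge of weight 1. These edges force the two copies of each argument to agree, so pinning the
  first copy pins the second.\<close>

lemma product_gibbs:
  assumes "(k, f) \<in> gibbs_functions" "(k, g) \<in> gibbs_functions"
  shows "(k, \<lambda>x\<in>cube k. f x * g x) \<in> gibbs_functions"
proof -
  obtain m t P V c where N1: "network k m t P V" and c: "0 \<le> c"
    and f: "\<And>x. length x = k \<Longrightarrow> f x = c * gibbs m t P V x"
    by (rule gibbs_functionsE[OF assms(1)]) blast
  obtain n u Q W d where N2: "network k n u Q W" and d: "0 \<le> d"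
    and g: "\<And>x. length x = k \<Longrightarrow> g x = d * gibbs n u Q W x"
    by (rule gibbs_functionsE[OF assms(2)]) blast
  have t: "length t = k" "set t \<subseteq> {..<m}" "i < k \<Longrightarrow> t ! i < m" for i
    using N1 by (auto simp: network_def subset_iff)
  have u: "length u = k" "set u \<subseteq> {..<n}" "i < k \<Longrightarrow> u ! i < n" for i
    using N2 by (auto simp: network_def subset_iff)
  define shift where "shift = (\<lambda>(a, b). (m + a, m + b :: nat))"
  \<comment> \<open>Different arguments may give the same pair, and \<open>C\<close> holds it once.
    The correction factor is therefore \<open>2 ^ card C\<close> and not
    \<open>2 ^ k\<close>.\<close>
  define C where "C = (\<lambda>i. (t ! i, m + u ! i)) ` {..<k}"
  \<comment> \<open>The vertex numbers reveal the origin of an edge: both ends below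
    \<open>m\<close> for \<open>P\<close>, both at least \<open>m\<close> for the shifted
    \<open>Q\<close>, one on each side for \<open>C\<close>.\<close>
  define U where "U = (\<lambda>(a, b). if b < m then V (a, b) else if a < m then 1 else W (a - m, b - m))"
  have fin: "finite P" "finite Q" "finite C"
    using N1 N2 by (auto simp: network_finite C_def)
  have inj: "inj_on shift Q"
    by (auto simp: inj_on_def shift_def)
  have disj: "P \<inter> shift ` Q = {}" "(P \<union> shift ` Q) \<inter> C = {}"
    using N1 t by (fastforce simp: network_def shift_def C_def)+
  have UP: "U p = V p" if "p \<in> P" for p
    using N1 that by (auto simp: network_def U_def split: prod.splits)
  have UQ: "U (shift p) = W p" for p
    by (auto simp: shift_def U_def split: prod.splits)
  have UC: "U p = 1" if "p \<in> C" for p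
    using t that by (auto simp: C_def U_def)
  have N: "network k (m + n) t (P \<union> shift ` Q \<union> C) U"
    unfolding network_def
  proof (intro conjI ballI)
    fix p assume "p \<in> P \<union> shift ` Q \<union> C"
    then consider "p \<in> P" | q where "q \<in> Q" "p = shift q" | "p \<in> C" by blast
    then have "fst p < snd p \<and> snd p < m + n \<and> 0 < U p \<and> U p \<le> 1"
    proof cases
      case 1
      then show ?thesis using N1 by (force simp: network_def UP)
    next
      case 2
      then show ?thesis using N2 by (auto simp: network_def UQ) (auto simp: shift_def split: prod.splits)
    next
      case 3
      then show ?thesis using t(3) u(3) UC[OF 3] t u by (auto simp: C_def) (meson trans_less_add1)
    qed
    then show "fst p < snd p" "snd p < m + n" "0 < U p" "U p \<le> 1" by auto
  qed (use t in auto)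
  \<comment> \<open>An edge of weight 1 contributes twice the indicator that its two spins agree.\<close>
  have C: "(\<Prod>p\<in>C. 1 + U p * (spin ((s @ r) ! fst p) * spin ((s @ r) ! snd p)))
      = 2 ^ card C * of_bool (map ((!) s) t = map ((!) r) u)"
    if "length s = m" for s r
  proof -
    have "(\<Prod>p\<in>C. 1 + U p * (spin ((s @ r) ! fst p) * spin ((s @ r) ! snd p)))
        = (\<Prod>p\<in>C. 2 * of_bool (s ! fst p = r ! (snd p - m)))"
      using that t by (intro prod.cong) (auto simp: UC spin_mult C_def nth_append)
    also have "\<dots> = 2 ^ card C * (\<Prod>p\<in>C. of_bool (s ! fst p = r ! (snd p - m)))"
      by (simp add: prod.distrib)
    also have "(\<Prod>p\<in>C. of_bool (s ! fst p = r ! (snd p - m)) :: real)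
        = of_bool (\<forall>p\<in>C. s ! fst p = r ! (snd p - m))"
      using fin(3) by (auto simp: prod_zero_iff)
    also have "(\<forall>p\<in>C. s ! fst p = r ! (snd p - m)) \<longleftrightarrow> map ((!) s) t = map ((!) r) u"
      using t u by (auto simp: C_def list_eq_iff_nth_eq)
    finally show ?thesis .
  qed
  have split: "boltzmann (P \<union> shift ` Q \<union> C) U (s @ r)
      = 2 ^ card C * of_bool (map ((!) s) t = map ((!) r) u) * boltzmann P V s * boltzmann Q W r"
    if "length s = m" "length r = n" for s r
  proof -
    have "boltzmann (P \<union> shift ` Q \<union> C) U (s @ r)
        = boltzmann P V (s @ r) * (\<Prod>p\<in>Q. 1 + W p *
            (spin ((s @ r) ! fst (shift p)) * spin ((s @ r) ! snd (shift p)))) * (2 ^ card C * of_bool (map ((!) s) t = map ((!) r) u))"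
      using fin disj
      by (simp add: boltzmann_def prod.union_disjoint prod.reindex[OF inj] UQ UP C[OF that(1)])
    also have "(\<Prod>p\<in>Q. 1 + W p * (spin ((s @ r) ! fst (shift p)) * spin ((s @ r) ! snd (shift p))))
        = boltzmann Q W r"
      unfolding boltzmann_def using that
      by (intro prod.cong) (auto simp: shift_def nth_append split: prod.splits)
    finally show ?thesis
      using boltzmann_append[OF N1] that by simp
  qed
  show ?thesis
  proof (rule gibbs_functionsI[OF N])
    show "0 \<le> c * d / 2 ^ card C" using c d by simp
    fix x :: "bool list"
    assume x: "length x = k"
    have "gibbs (m + n) t (P \<union> shift ` Q \<union> C) U x
        = (\<Sum>s\<in>cube m. \<Sum>r\<in>cube n. of_bool (map ((!) s) t = x) *
            (2 ^ card C * of_bool (map ((!) s) t = map ((!) r) u) * boltzmann P V s * boltzmann Q W r))"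
      unfolding gibbs_def sum_cube_add using t(2)
      by (intro sum.cong refl) (simp add: split map_nth_append)
    \<comment> \<open>Once the first copy reads \<open>x\<close>, agreement of the copies means that
      the second reads \<open>x\<close> too. This decouples the two sums.\<close>
    also have "\<dots> = (\<Sum>s\<in>cube m. \<Sum>r\<in>cube n. 2 ^ card C *
        ((of_bool (map ((!) s) t = x) * boltzmann P V s) *
         (of_bool (map ((!) r) u = x) * boltzmann Q W r)))"
      by (intro sum.cong refl) auto
    also have "\<dots> = 2 ^ card C * (gibbs m t P V x * gibbs n u Q W x)"
      unfolding gibbs_def sum_product by (simp only: sum_distrib_left)
    finally show "f x * g x = c * d / 2 ^ card C * gibbs (m + n) t (P \<union> shift ` Q \<union> C) U x"
      using f[OF x] g[OF x] by simp
  qed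
qed

lemma clone_subset_gibbs:
  "clone ({Ising l | l. 0 \<le> l \<and> l \<le> 1} \<union> B 0) \<subseteq> gibbs_functions"
proof
  fix f
  assume "f \<in> clone ({Ising l | l. 0 \<le> l \<and> l \<le> 1} \<union> B 0)"
  then show "f \<in> gibbs_functions"
    by induction
      (auto intro: Ising_gibbs B_0_gibbs EQ_gibbs fictitious_gibbs permute_gibbs product_gibbs
        summation_gibbs)
qed

section \<open>Partition functions in the clone\<close>

lemma clone_cong:
  assumes "(k, restrict f (cube k)) \<in> clone F" "\<And>x. length x = k \<Longrightarrow> f x = g x"
  shows "(k, restrict g (cube k)) \<in> clone F"
proof -
  have "restrict f (cube k) = restrict g (cube k)"
    using assms(2) by (intro restrict_ext) simp
  then show ?thesis using assms(1) by simp
qed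

lemma clone_const:
  assumes "B 0 \<subseteq> F" "0 \<le> c"
  shows "(k, \<lambda>x\<in>cube k. c) \<in> clone F"
proof (induction k)
  case 0
  have "(0, \<lambda>x\<in>cube 0. c) \<in> B 0"
    using assms(2) by (auto simp: B_def)
  then show ?case using assms(1) by (blast intro: clone.generator)
next
  case (Suc k)
  from clone.fictitious[OF Suc le0] show ?case
    by (rule clone_cong) (simp add: delete_at_def)
qed

lemma clone_mult:
  assumes "(k, restrict f (cube k)) \<in> clone F" "(k, restrict g (cube k)) \<in> clone F"
  shows "(k, \<lambda>x\<in>cube k. f x * g x) \<in> clone F"
  using clone.product[OF assms] by (rule clone_cong) simp

lemma clone_prod:
  assumes "B 0 \<subseteq> F" "finite S" "\<And>s. s \<in> S \<Longrightarrow> (k, restrict (g s) (cube k)) \<in> clone F"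
  shows "(k, \<lambda>x\<in>cube k. \<Prod>s\<in>S. g s x) \<in> clone F"
  using assms(2,3)
proof (induction S)
  case empty
  then show ?case unfolding prod.empty by (intro clone_const[OF assms(1)]) simp
next
  case (insert s S)
  have "(k, restrict (g s) (cube k)) \<in> clone F"
    by (rule insert.prems) simp
  moreover have "(k, \<lambda>x\<in>cube k. \<Prod>s\<in>S. g s x) \<in> clone F"
    by (rule insert.IH, rule insert.prems) simp
  ultimately show ?case
    unfolding prod.insert[OF insert.hyps] by (rule clone_mult)
qed

text \<open>Append fictitious arguments after the first two, then permute positions 0 and 1 to
  \<open>a\<close> and \<open>b\<close>.\<close>

lemma clone_pair:
  assumes h: "(2, restrict h (cube 2)) \<in> clone F" and "a < m" "b < m" "a \<noteq> b"
  shows "(m, \<lambda>x\<in>cube m. h [x ! a, x ! b]) \<in> clone F"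
proof -
  have pad: "(2 + j, \<lambda>x\<in>cube (2 + j). h (take 2 x)) \<in> clone F" for j
  proof (induction j)
    case 0
    show ?case unfolding add_0_right using h by (rule clone_cong) simp
  next
    case (Suc j)
    have "(Suc (2 + j), \<lambda>x\<in>cube (Suc (2 + j)). h (take 2 x)) \<in> clone F"
      using clone.fictitious[OF Suc, of "2 + j"]
      by (rule clone_cong) (auto simp: delete_at_def min_def)
    then show ?case by (simp only: add_Suc_right)
  qed
  \<comment> \<open>The inner transposition sends 1 to the preimage of \<open>b\<close> under the
    outer one. That preimage is not 0 because \<open>a \<noteq> b\<close>, so 0 still goes to
    \<open>a\<close>, even when \<open>b = 0\<close> or \<open>a = 1\<close>.\<close>
  define \<pi> where "\<pi> = Transposition.transpose 0 a \<circ>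
    Transposition.transpose 1 (Transposition.transpose 0 a b)"
  have "Transposition.transpose 0 a b < m"
    using assms by (auto simp: Transposition.transpose_def)
  then have perm: "\<pi> permutes {..<m}"
    using assms unfolding \<pi>_def by (intro permutes_compose permutes_swap_id) auto
  have \<pi>: "\<pi> 0 = a" "\<pi> (Suc 0) = b"
    using assms by (auto simp: \<pi>_def Transposition.transpose_def)
  obtain j where m: "m = 2 + j"
    using assms by (intro that[of "m - 2"]) auto
  have take: "take 2 (map f [0..<m]) = [f 0, f 1]" for f :: "nat \<Rightarrow> bool"
    unfolding take_map m by (subst take_upt) (simp_all add: numeral_2_eq_2)
  from clone.permute[OF pad[of j, folded m] perm] show ?thesis
    by (rule clone_cong) (simp add: take \<pi>)
qed

lemma clone_sum_prefix:
  "(n + k, restrict f (cube (n + k))) \<in> clone F \<Longrightarrow>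
   (k, \<lambda>x\<in>cube k. \<Sum>s\<in>cube n. f (s @ x)) \<in> clone F"
proof (induction n arbitrary: f)
  case 0
  then show ?case by simp
next
  case (Suc n)
  have "(n + k, \<lambda>x\<in>cube (n + k). \<Sum>b\<in>UNIV. f (b # x)) \<in> clone F"
    using clone.summation[OF Suc.prems[unfolded add_Suc] le0]
    by (rule clone_cong) (simp add: insert_at_def)
  from Suc.IH[OF this] show ?case
    by (rule clone_cong) (simp add: sum_cube_Suc)
qed

text \<open>Work with \<open>n + k\<close> variables, the spins before the arguments. Copies of
  \<open>EQ\<close> tie argument \<open>i\<close> to spin \<open>t ! i\<close>, scaled copies of
  \<open>Ising\<close> give the edge factors, and summing out the first \<open>n\<close> variables
  leaves the partition function.\<close>

lemma gibbs_clone: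
  assumes N: "network k n t P W" and "0 \<le> c"
  shows "(k, \<lambda>x\<in>cube k. c * gibbs n t P W x) \<in> clone ({Ising l | l. 0 \<le> l \<and> l \<le> 1} \<union> B 0)"
    (is "_ \<in> clone ?F")
proof -
  have B0: "B 0 \<subseteq> ?F" by blast
  have t: "length t = k" "set t \<subseteq> {..<n}" "i < k \<Longrightarrow> t ! i < n" for i
    using N by (auto simp: network_def subset_iff)
  have eq: "(n + k, \<lambda>z\<in>cube (n + k). if z ! (t ! i) = z ! (n + i) then 1 else 0) \<in> clone ?F"
    if "i < k" for i
  proof -
    have "(2, \<lambda>x\<in>cube 2. if x ! 0 = x ! 1 then 1 else 0) \<in> clone ?F"
      using clone.equality[of ?F] by (simp add: EQ_def)
    from clone_pair[OF this, of "t ! i" "n + k" "n + i"] show ?thesis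
      using t(3)[OF that] that by simp
  qed
  have link: "(n + k, \<lambda>z\<in>cube (n + k). 1 + W p * (spin (z ! fst p) * spin (z ! snd p))) \<in> clone ?F"
    if "p \<in> P" for p
  proof -
    have p: "fst p < snd p" "snd p < n" "0 < W p" "W p \<le> 1"
      using N that by (auto simp: network_def)
    \<comment> \<open>The edge factor is \<open>1 + W p\<close> on equal spins and
      \<open>1 - W p\<close> on unequal ones; dividing by the former normalises it to an Ising
      function.\<close>
    let ?l = "(1 - W p) / (1 + W p)"
    have "Ising ?l \<in> clone ?F"
      using p by (intro clone.generator) auto
    then have "(2, \<lambda>x\<in>cube 2. if x ! 0 = x ! 1 then 1 else ?l) \<in> clone ?F"
      by (simp add: Ising_def)
    from clone_pair[OF this, of "fst p" "n + k" "snd p"]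
    have *: "(n + k, \<lambda>z\<in>cube (n + k). if z ! fst p = z ! snd p then 1 else ?l) \<in> clone ?F"
      using p by simp
    have "0 \<le> 1 + W p" using p by simp
    from clone_mult[OF clone_const[OF B0 this] *] show ?thesis
      by (rule clone_cong) (use p in \<open>auto simp: spin_mult\<close>)
  qed
  have "(n + k, \<lambda>z\<in>cube (n + k). c *
      ((\<Prod>i<k. if z ! (t ! i) = z ! (n + i) then 1 else 0) *
       (\<Prod>p\<in>P. 1 + W p * (spin (z ! fst p) * spin (z ! snd p))))) \<in> clone ?F"
    by (intro clone_mult clone_const clone_prod B0 assms finite_lessThan network_finite[OF N])
      (use eq link in auto)
  from clone_sum_prefix[OF this] show ?thesis
  proof (rule clone_cong)
    fix x :: "bool list"
    assume x: "length x = k"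
    have "(\<Prod>i<k. if (s @ x) ! (t ! i) = (s @ x) ! (n + i) then 1 else 0 :: real)
        = of_bool (map ((!) s) t = x)" if "length s = n" for s
    proof -
      have "(\<Prod>i<k. if (s @ x) ! (t ! i) = (s @ x) ! (n + i) then 1 else 0 :: real)
          = (\<Prod>i<k. of_bool (s ! (t ! i) = x ! i))"
        using t(3) that by (intro prod.cong) (auto simp: nth_append)
      also have "\<dots> = of_bool (\<forall>i<k. s ! (t ! i) = x ! i)"
        by (auto simp: prod_zero_iff)
      also have "(\<forall>i<k. s ! (t ! i) = x ! i) \<longleftrightarrow> map ((!) s) t = x"
        using t(1) x by (auto simp: list_eq_iff_nth_eq)
      finally show ?thesis .
    qed
    then show "(\<Sum>s\<in>cube n. c *
      ((\<Prod>i<k. if (s @ x) ! (t ! i) = (s @ x) ! (n + i) then 1 else 0) *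
       (\<Prod>p\<in>P. 1 + W p * (spin ((s @ x) ! fst p) * spin ((s @ x) ! snd p)))))
      = c * gibbs n t P W x"
      unfolding gibbs_def sum_distrib_left
      using boltzmann_append[OF N] by (intro sum.cong) (auto simp: boltzmann_def)
  qed
qed

section \<open>High temperature expansion\<close>

definition circuit_edges :: "nat \<Rightarrow> nat list \<Rightarrow> (nat \<times> nat) set \<Rightarrow> vertex set set" where
  "circuit_edges k t P =
     (\<lambda>i. {Ext i, Inn (t ! i)}) ` {..<k} \<union> (\<lambda>p. {Inn (fst p), Inn (snd p)}) ` P"

lemma terminal_circuit_edges:
  "i < k \<Longrightarrow> terminal (circuit_edges k t P) i = {Ext i, Inn (t ! i)}"
  unfolding terminal_def circuit_edges_def by (rule the_equality) auto

lemma degree_external: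
  assumes "H \<subseteq> circuit_edges k t P" "i < k"
  shows "degree H (Ext i) = of_bool ({Ext i, Inn (t ! i)} \<in> H)"
proof -
  have "e = {Ext i, Inn (t ! i)}" if "e \<in> H" "Ext i \<in> e" for e
    using assms that by (auto simp: circuit_edges_def)
  then have "{e \<in> H. Ext i \<in> e} = H \<inter> {{Ext i, Inn (t ! i)}}"
    by blast
  then show ?thesis by (simp add: degree_def)
qed

text \<open>Double counting of incidences: each vertex value appears once for every edge of
  \<open>H\<close> at that vertex. This is how parities of degrees enter.\<close>

lemma prod_edges_eq_prod_degree:
  fixes g :: "vertex \<Rightarrow> 'a::comm_monoid_mult"
  assumes "finite H" "finite V" "\<And>e. e \<in> H \<Longrightarrow> e \<subseteq> V"
  shows "(\<Prod>e\<in>H. \<Prod>v\<in>e. g v) = (\<Prod>v\<in>V. g v ^ degree H v)"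
proof -
  have "(\<Prod>e\<in>H. \<Prod>v\<in>e. g v) = (\<Prod>e\<in>H. \<Prod>v\<in>{v \<in> V. v \<in> e}. g v)"
    using assms(3) by (intro prod.cong) (auto simp: Collect_conj_eq Int_absorb1)
  also have "\<dots> = (\<Prod>v\<in>V. \<Prod>e\<in>{e \<in> H. v \<in> e}. g v)"
    using assms by (intro prod.swap_restrict)
  finally show ?thesis by (simp add: degree_def)
qed

lemma network_edges_finite: "network k n t P W \<Longrightarrow> finite (circuit_edges k t P)"
  by (simp add: circuit_edges_def network_finite)

lemma network_edges_vertices:
  "network k n t P W \<Longrightarrow> e \<in> circuit_edges k t P \<Longrightarrow> e \<subseteq> vertices k n"
  by (auto simp: network_def circuit_edges_def vertices_def subset_iff)

text \<open>A terminal has weight 1, so its factor is twice the indicator that the spin at its inner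
  end equals the argument. The \<open>k\<close> terminals together do the pinning; the other edges
  give the Boltzmann weight.\<close>

lemma prod_edges_expansion:
  assumes "length y = k" "network k n t P W" "length s = n"
    and w: "\<And>i. i < k \<Longrightarrow> w {Ext i, Inn (t ! i)} = 1"
      "\<And>p. p \<in> P \<Longrightarrow> w {Inn (fst p), Inn (snd p)} = W p"
  shows "(\<Prod>e\<in>circuit_edges k t P. 1 + w e *
      (\<Prod>v\<in>e. case_vertex (\<lambda>i. spin (y ! i)) (\<lambda>j. spin (s ! j)) v))
     = 2 ^ k * of_bool (map ((!) s) t = y) * boltzmann P W s" (is "prod ?h _ = _")
proof -
  let ?T = "\<lambda>i. {Ext i, Inn (t ! i)}" and ?L = "\<lambda>p. {Inn (fst p), Inn (snd p)}"
  have N: "fst p < snd p" if "p \<in> P" for p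
    using assms(2) that by (simp add: network_def)
  have inj: "inj_on ?T {..<k}" "inj_on ?L P"
    using N by (auto simp: inj_on_def doubleton_eq_iff) (metis less_asym)+
  have "prod ?h (circuit_edges k t P) = prod ?h (?T ` {..<k}) * prod ?h (?L ` P)"
    unfolding circuit_edges_def using network_finite[OF assms(2)]
    by (intro prod.union_disjoint) auto
  also have "prod ?h (?L ` P) = boltzmann P W s"
    unfolding boltzmann_def prod.reindex[OF inj(2)]
    using N by (intro prod.cong) (auto simp: w(2) dest!: N)
  also have "prod ?h (?T ` {..<k}) = (\<Prod>i<k. 2 * of_bool (s ! (t ! i) = y ! i))"
    unfolding prod.reindex[OF inj(1)] by (intro prod.cong) (auto simp: w(1) spin_mult)
  also have "\<dots> = 2 ^ k * (\<Prod>i<k. of_bool (s ! (t ! i) = y ! i))"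
    by (simp add: prod.distrib)
  also have "(\<Prod>i<k. of_bool (s ! (t ! i) = y ! i) :: real) = of_bool (\<forall>i<k. s ! (t ! i) = y ! i)"
    by (auto simp: prod_zero_iff)
  also have "(\<forall>i<k. s ! (t ! i) = y ! i) \<longleftrightarrow> map ((!) s) t = y"
    using assms by (auto simp: network_def list_eq_iff_nth_eq)
  finally show ?thesis .
qed

text \<open>Summing a power of one spin over both values gives 2 for an even exponent and 0 for an
  odd one, which enforces even internal degrees. External degrees are 0 or 1, so the external spins
  multiply to the character of the set of terminals in \<open>H\<close>.\<close>

lemma sum_spins_subgraph:
  assumes "network k n t P W" "H \<subseteq> circuit_edges k t P" "length y = k"
  shows "(\<Sum>s\<in>cube n. \<Prod>e\<in>H. w e * (\<Prod>v\<in>e. case_vertex (\<lambda>i. spin (y ! i)) (\<lambda>j. spin (s ! j)) v))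
     = 2 ^ n * of_bool (\<forall>j<n. even (degree H (Inn j))) *
       (character y (map (\<lambda>i. {Ext i, Inn (t ! i)} \<in> H) [0..<k]) * (\<Prod>e\<in>H. w e))"
proof -
  have fin: "finite H"
    using assms network_edges_finite finite_subset by blast
  have sub: "e \<subseteq> vertices k n" if "e \<in> H" for e
    using assms network_edges_vertices that by blast
  have V: "(\<Prod>v\<in>vertices k n. g v) = (\<Prod>i<k. g (Ext i)) * (\<Prod>j<n. g (Inn j))" for g :: "vertex \<Rightarrow> real"
    unfolding vertices_def by (subst prod.union_disjoint) (auto simp: prod.reindex inj_on_def)
  have ext: "(\<Prod>i<k. spin (y ! i) ^ degree H (Ext i))
      = character y (map (\<lambda>i. {Ext i, Inn (t ! i)} \<in> H) [0..<k])"
    using assms degree_external[OF assms(2)]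
    by (subst character_eq_prod[of _ k]) (auto simp: spin_def intro!: prod.cong)
  have "(\<Sum>s\<in>cube n. \<Prod>e\<in>H. w e * (\<Prod>v\<in>e. case_vertex (\<lambda>i. spin (y ! i)) (\<lambda>j. spin (s ! j)) v))
      = (\<Sum>s\<in>cube n. (\<Prod>e\<in>H. w e) * ((\<Prod>i<k. spin (y ! i) ^ degree H (Ext i)) *
          (\<Prod>j<n. spin (s ! j) ^ degree H (Inn j))))"
    unfolding prod.distrib
    using sub
    by (subst prod_edges_eq_prod_degree[OF fin, of "vertices k n"])
      (auto simp: V, simp add: vertices_def)
  also have "\<dots> = (\<Prod>e\<in>H. w e) * ((\<Prod>i<k. spin (y ! i) ^ degree H (Ext i)) *
      (\<Sum>s\<in>cube n. \<Prod>j<n. spin (s ! j) ^ degree H (Inn j)))"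
    by (simp add: sum_distrib_left)
  also have "(\<Sum>s\<in>cube n. \<Prod>j<n. spin (s ! j) ^ degree H (Inn j))
      = (\<Prod>j<n. 2 * of_bool (even (degree H (Inn j))))"
    using sum_cube_prod[of "\<lambda>j b. spin b ^ degree H (Inn j)" n]
    by (auto simp: spin_def intro!: prod.cong)
  also have "\<dots> = 2 ^ n * (\<Prod>j<n. of_bool (even (degree H (Inn j))))"
    by (simp add: prod.distrib)
  also have "(\<Prod>j<n. of_bool (even (degree H (Inn j))) :: real)
      = of_bool (\<forall>j<n. even (degree H (Inn j)))"
    by (auto simp: prod_zero_iff)
  finally show ?thesis by (simp add: ext)
qed

text \<open>Expand the product over edges into a sum over edge sets \<open>H\<close> and sum out the
  spins. The power \<open>2 ^ k\<close> comes from pinning by terminals, \<open>2 ^ n\<close> from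
  the spin sums.\<close>

lemma gibbs_eq_inverse_fourier:
  assumes N: "network k n t P W" and y: "length y = k"
    and w: "\<And>i. i < k \<Longrightarrow> w {Ext i, Inn (t ! i)} = 1"
      "\<And>p. p \<in> P \<Longrightarrow> w {Inn (fst p), Inn (snd p)} = W p"
  shows "2 ^ k / 2 ^ n * gibbs n t P W y =
    (\<Sum>x\<in>cube k. character y x *
      (\<Sum>H\<in>even_subgraphs k n (circuit_edges k t P) x. \<Prod>e\<in>H. w e))"
proof -
  let ?E = "circuit_edges k t P"
  let ?x = "\<lambda>H. map (\<lambda>i. {Ext i, Inn (t ! i)} \<in> H) [0..<k]"
  let ?g = "\<lambda>s. case_vertex (\<lambda>i. spin (y ! i)) (\<lambda>j. spin (s ! j))"
  define S where "S = {H \<in> Pow ?E. \<forall>j<n. even (degree H (Inn j))}"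
  have fin: "finite ?E" by (rule network_edges_finite[OF N])
  have even: "even_subgraphs k n ?E x = {H \<in> S. ?x H = x}" if "length x = k" for x
    using that by (auto simp: even_subgraphs_def S_def terminal_circuit_edges list_eq_iff_nth_eq)
  have "2 ^ k * gibbs n t P W y = (\<Sum>s\<in>cube n. \<Prod>e\<in>?E. 1 + w e * (\<Prod>v\<in>e. ?g s v))"
    unfolding gibbs_def sum_distrib_left
    using prod_edges_expansion[OF y N _ w] by (intro sum.cong) auto
  also have "\<dots> = (\<Sum>s\<in>cube n. \<Sum>H\<in>Pow ?E. \<Prod>e\<in>H. w e * (\<Prod>v\<in>e. ?g s v))"
    using prod_add[OF fin, of "\<lambda>e. w e * (\<Prod>v\<in>e. ?g s v)" "\<lambda>_. 1" for s]
    by (simp add: add.commute)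
  also have "\<dots> = (\<Sum>H\<in>Pow ?E. \<Sum>s\<in>cube n. \<Prod>e\<in>H. w e * (\<Prod>v\<in>e. ?g s v))"
    by (rule sum.swap)
  also have "\<dots> = (\<Sum>H\<in>Pow ?E. 2 ^ n * of_bool (\<forall>j<n. even (degree H (Inn j))) *
      (character y (?x H) * (\<Prod>e\<in>H. w e)))"
    using sum_spins_subgraph[OF N _ y] by (intro sum.cong) auto
  also have "\<dots> = (\<Sum>H\<in>S. 2 ^ n * (character y (?x H) * (\<Prod>e\<in>H. w e)))"
    unfolding S_def using fin by (subst sum.inter_filter) (auto intro!: sum.cong)
  also have "\<dots> = 2 ^ n * (\<Sum>H\<in>S. character y (?x H) * (\<Prod>e\<in>H. w e))"
    by (simp add: sum_distrib_left)
  \<comment> \<open>Grouping the even edge sets by the terminals they contain collects the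
    coefficient of each character.\<close>
  also have "(\<Sum>H\<in>S. character y (?x H) * (\<Prod>e\<in>H. w e))
      = (\<Sum>x\<in>cube k. \<Sum>H\<in>{H \<in> S. ?x H = x}. character y (?x H) * (\<Prod>e\<in>H. w e))"
    by (rule sum.group[symmetric]) (auto simp: S_def fin)
  also have "\<dots> = (\<Sum>x\<in>cube k. character y x * (\<Sum>H\<in>even_subgraphs k n ?E x. \<Prod>e\<in>H. w e))"
    unfolding sum_distrib_left by (intro sum.cong) (auto simp: even)
  finally show ?thesis by simp
qed

section \<open>From partition functions to circuits and back\<close>

lemma boltzmann_nonneg:
  assumes "network k n t P W"
  shows "0 \<le> boltzmann P W s"
  unfolding boltzmann_def
  using assms by (intro prod_nonneg) (auto simp: network_def spin_mult)

lemma gibbs_nonneg: "network k n t P W \<Longrightarrow> 0 \<le> gibbs n t P W x"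
  unfolding gibbs_def by (intro sum_nonneg mult_nonneg_nonneg boltzmann_nonneg) auto

lemma gibbs_subset_even_circuit: "gibbs_functions \<subseteq> even_circuit_functions"
proof
  fix F
  assume "F \<in> gibbs_functions"
  then obtain k n t P W c where F: "F = (k, \<lambda>x\<in>cube k. c * gibbs n t P W x)"
    and c: "0 \<le> c" and N: "network k n t P W"
    unfolding gibbs_functions_def by blast
  let ?T = "\<lambda>i. {Ext i, Inn (t ! i)}" and ?L = "\<lambda>p. {Inn (fst p), Inn (snd p)}"
  have t: "length t = k" "i < k \<Longrightarrow> t ! i < n" for i
    using N by (auto simp: network_def subset_iff)
  have P: "fst p < snd p \<and> snd p < n \<and> 0 < W p \<and> W p \<le> 1" if "p \<in> P" for p
    using N that by (auto simp: network_def)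
  define E where "E = circuit_edges k t P"
  \<comment> \<open>An inner edge finds its weight by inverting the map from pairs to edges, which
    is injective since pairs are increasing.\<close>
  define w where "w = (\<lambda>e. if e \<in> ?T ` {..<k} then 1 else W (inv_into P ?L e))"
  define f where "f = (\<lambda>y. 2 ^ k / 2 ^ n * gibbs n t P W y)"
  have inj: "inj_on ?L P"
    using P by (auto simp: inj_on_def doubleton_eq_iff) (metis less_asym fst_conv snd_conv)+
  have w: "w (?T i) = 1" if "i < k" for i
    using that by (auto simp: w_def)
  have wL: "w (?L p) = W p" if "p \<in> P" for p
    using that inv_into_f_f[OF inj that] by (auto simp: w_def)
  have terminal_eq: "terminal E i = ?T i" if "i < k" for i
    using that by (simp add: E_def terminal_circuit_edges)
  \<comment> \<open>A network may have fewer vertices than arguments. Adding \<open>k\<close>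
    isolated internal vertices secures the bound that circuits require.\<close>
  have circuit: "even_circuit k (n + k) E w"
  proof
    show "k \<le> n + k" by simp
    show "E \<subseteq> {{a, b} |a b. a \<in> vertices k (n + k) \<and> b \<in> vertices k (n + k) \<and> a \<noteq> b}"
    proof
      fix e assume "e \<in> E"
      then consider i where "i < k" "e = ?T i" | p where "p \<in> P" "e = ?L p"
        by (auto simp: E_def circuit_edges_def)
      then show "e \<in> {{a, b} |a b. a \<in> vertices k (n + k) \<and> b \<in> vertices k (n + k) \<and> a \<noteq> b}"
      proof cases
        case 1
        then show ?thesis using t(2)[OF 1(1)]
          by (intro CollectI exI[of _ "Ext i"] exI[of _ "Inn (t ! i)"]) (auto simp: vertices_def)
      next
        case 2
        then show ?thesis using P[OF 2(1)]
          by (intro CollectI exI[of _ "Inn (fst p)"] exI[of _ "Inn (snd p)"]) (auto simp: vertices_def)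
      qed
    qed
    show "degree E (Ext i) = 1" if "i < k" for i
      using degree_external[of E k t P i] that by (simp add: E_def) (simp add: circuit_edges_def)
    show "inj_on (terminal E) {..<k}"
      by (auto simp: inj_on_def terminal_eq)
    show "w (terminal E i) = 1" if "i < k" for i
      using that by (simp add: terminal_eq w)
    show "0 < w e \<and> w e \<le> 1" if "e \<in> E - terminal E ` {..<k}" for e
      using that P wL
      by (auto simp: E_def circuit_edges_def terminal_eq[unfolded E_def circuit_edges_def])
  qed
  have isolated: "degree H (Inn j) = 0" if "H \<subseteq> E" "n \<le> j" for H j
  proof -
    have "{e \<in> H. Inn j \<in> e} = {}"
      using that network_edges_vertices[OF N] by (fastforce simp: E_def vertices_def)
    then show ?thesis unfolding degree_def by (simp only: card.empty)
  qed
  \<comment> \<open>The added vertices have degree 0, which is even, so they impose no condition and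
    the scaling keeps the exponent \<open>n\<close>.\<close>
  have even: "even_subgraphs k (n + k) E x = even_subgraphs k n E x" for x
    unfolding even_subgraphs_def using isolated
    by (intro Collect_cong) (metis even_zero not_le trans_less_add1)
  have "f y = (\<Sum>x\<in>cube k. character y x * (\<Sum>H\<in>even_subgraphs k n E x. \<Prod>e\<in>H. w e))"
    if "length y = k" for y
    unfolding f_def E_def by (rule gibbs_eq_inverse_fourier[OF N that w wL])
  then have "circuit_implements k (n + k) E w (fourier k f)"
    unfolding circuit_implements_def even by (simp add: fourier_of_inverse)
  moreover have F': "F = (k, \<lambda>x\<in>cube k. c * 2 ^ n / 2 ^ k * f x)"
    unfolding F f_def by (auto intro!: restrict_ext)
  \<comment> \<open>Weights are at most 1, so no edge factor is negative.\<close>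
  moreover have "F \<in> B k"
    unfolding F B_def using c gibbs_nonneg[OF N] by auto
  ultimately show "F \<in> even_circuit_functions"
    unfolding even_circuit_functions_def using c circuit
    by (intro CollectI exI[of _ k] exI[of _ "c * 2 ^ n / 2 ^ k"] exI[of _ f] exI[of _ "n + k"]
        exI[of _ E] exI[of _ w] conjI) auto
qed

text \<open>Each terminal leads from its external vertex to one internal vertex, which becomes the
  spin read by that argument. The remaining edges join internal vertices and are stored with the
  smaller index first.\<close>

lemma even_circuit_is_network:
  assumes "even_circuit k n E w"
  obtains t P where "network k n t P (\<lambda>p. w {Inn (fst p), Inn (snd p)})"
    "E = circuit_edges k t P" "\<And>i. i < k \<Longrightarrow> w {Ext i, Inn (t ! i)} = 1"
proof -
  interpret even_circuit k n E w by fact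
  have terminal_props: "terminal E i \<in> E" "Ext i \<in> terminal E i"
      "\<And>e. e \<in> E \<Longrightarrow> Ext i \<in> e \<Longrightarrow> e = terminal E i"
    if i: "i < k" for i
  proof -
    obtain e where e: "{e \<in> E. Ext i \<in> e} = {e}"
      using external_degree[OF i] by (auto simp: degree_def card_1_singleton_iff)
    then have "terminal E i = e"
      unfolding terminal_def by (intro the_equality) auto
    then show "terminal E i \<in> E" "Ext i \<in> terminal E i"
        "\<And>e. e \<in> E \<Longrightarrow> Ext i \<in> e \<Longrightarrow> e = terminal E i"
      using e by auto
  qed
  have "\<exists>j<n. terminal E i = {Ext i, Inn j}" if i: "i < k" for i
  proof -
    obtain a b where ab: "terminal E i = {a, b}" "a \<in> vertices k n" "b \<in> vertices k n" "a \<noteq> b"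
      using subsetD[OF edges terminal_props(1)[OF i]] by blast
    moreover have "a = Ext i \<or> b = Ext i"
      using terminal_props(2)[OF i] unfolding ab(1) by auto
    ultimately obtain v where v: "terminal E i = {Ext i, v}" "v \<in> vertices k n" "v \<noteq> Ext i"
      by (metis insert_commute)
    \<comment> \<open>An edge between two external vertices would be the terminal of both, against
      the distinctness of terminals.\<close>
    have "v \<noteq> Ext j" if "j < k" for j
    proof
      assume "v = Ext j"
      then have "terminal E i = terminal E j"
        using terminal_props(1)[OF i] v(1) by (intro terminal_props(3)[OF that]) auto
      then show False
        using terminals_distinct i that v \<open>v = Ext j\<close> by (auto simp: inj_on_def)
    qed
    then show ?thesis using v by (auto simp: vertices_def)
  qed
  then obtain h where h: "\<And>i. i < k \<Longrightarrow> h i < n \<and> terminal E i = {Ext i, Inn (h i)}"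
    by metis
  define t where "t = map h [0..<k]"
  define P where "P = {p. fst p < snd p \<and> snd p < n \<and> {Inn (fst p), Inn (snd p)} \<in> E}"
  have t: "terminal E i = {Ext i, Inn (t ! i)}" if "i < k" for i
    using that h by (simp add: t_def)
  have internal_edge: "e \<in> (\<lambda>p. {Inn (fst p), Inn (snd p)}) ` P"
    if e: "e \<in> E" "\<And>i. i < k \<Longrightarrow> Ext i \<notin> e" for e
  proof -
    obtain a b where ab: "e = {a, b}" "a \<in> vertices k n" "b \<in> vertices k n" "a \<noteq> b"
      using subsetD[OF edges e(1)] by blast
    then obtain i j where ij: "a = Inn i" "b = Inn j" "i < n" "j < n" "i \<noteq> j"
      using e(2) by (auto simp: vertices_def)
    then have "e = {Inn (fst (min i j, max i j)), Inn (snd (min i j, max i j))}"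
      using ab by (auto simp: min_def max_def)
    moreover have "(min i j, max i j) \<in> P"
      using calculation ij e(1) by (auto simp: P_def min_def max_def)
    ultimately show ?thesis by blast
  qed
  have E: "E = circuit_edges k t P"
  proof
    show "E \<subseteq> circuit_edges k t P"
    proof
      fix e
      assume e: "e \<in> E"
      show "e \<in> circuit_edges k t P"
      proof (cases "\<exists>i<k. Ext i \<in> e")
        case True
        then obtain i where i: "i < k" "Ext i \<in> e" by blast
        then have "e = {Ext i, Inn (t ! i)}"
          using terminal_props(3)[OF i(1) e i(2)] t by simp
        then show ?thesis using i(1) by (simp add: circuit_edges_def)
      next
        case False
        then show ?thesis using internal_edge[OF e] by (auto simp: circuit_edges_def)
      qed
    qed
    show "circuit_edges k t P \<subseteq> E"
      using terminal_props(1) by (auto simp: circuit_edges_def P_def t[symmetric])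
  qed
  have "0 < w {Inn (fst p), Inn (snd p)} \<and> w {Inn (fst p), Inn (snd p)} \<le> 1" if "p \<in> P" for p
    using that t by (intro weight) (auto simp: P_def)
  then have "network k n t P (\<lambda>p. w {Inn (fst p), Inn (snd p)})"
    using h by (auto simp: network_def t_def P_def)
  then show thesis
    using E terminal_weight t by (intro that) auto
qed

text \<open>The circuit gives the Fourier transform of \<open>f\<close>; inverting it and reading
  the high temperature expansion backwards makes \<open>f\<close> a multiple of a partition
  function.\<close>

lemma even_circuit_subset_clone:
  "even_circuit_functions \<subseteq> clone ({Ising l | l. 0 \<le> l \<and> l \<le> 1} \<union> B 0)"
proof
  fix F
  assume "F \<in> even_circuit_functions"
  then obtain k c f n E w where F: "F = (k, \<lambda>x\<in>cube k. c * f x)" and c: "0 \<le> c"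
    and circuit: "even_circuit k n E w" "circuit_implements k n E w (fourier k f)"
    unfolding even_circuit_functions_def by blast
  obtain t P where N: "network k n t P (\<lambda>p. w {Inn (fst p), Inn (snd p)})"
    and E: "E = circuit_edges k t P" and w: "\<And>i. i < k \<Longrightarrow> w {Ext i, Inn (t ! i)} = 1"
    by (rule even_circuit_is_network[OF circuit(1)]) blast
  let ?W = "\<lambda>p. w {Inn (fst p), Inn (snd p)}"
  have "f y = 2 ^ k / 2 ^ n * gibbs n t P ?W y" if "length y = k" for y
  proof -
    have "f y = (\<Sum>x\<in>cube k. character y x * fourier k f x)"
      using fourier_inversion[OF that] by simp
    also have "\<dots> = 2 ^ k / 2 ^ n * gibbs n t P ?W y"
      using circuit(2) gibbs_eq_inverse_fourier[OF N that w refl]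
      by (simp add: circuit_implements_def E)
    finally show ?thesis .
  qed
  then have "F = (k, \<lambda>x\<in>cube k. (c * (2 ^ k / 2 ^ n)) * gibbs n t P ?W x)"
    unfolding F by (auto intro!: restrict_ext)
  then show "F \<in> clone ({Ising l | l. 0 \<le> l \<and> l \<le> 1} \<union> B 0)"
    using gibbs_clone[OF N, of "c * (2 ^ k / 2 ^ n)"] c by simp
qed

theorem theorem8p4:
  "clone ({Ising l | l. 0 \<le> l \<and> l \<le> 1} \<union> B 0) = even_circuit_functions"
  using clone_subset_gibbs gibbs_subset_even_circuit even_circuit_subset_clone by blast

end
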